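(* Let $q$ be a complex-valued potential that is bounded over its support, the support being assumed compact, and let $r=\kappa q^*$ with $\kappa\in\{+1,-1\}$. Fix $\xi\in\mathbb{R}$ and take the spectral parameter $\zeta=\xi$. If $\sum_{j=1}^s b_j=1$, then the integrating-factor (exponential) $s$-stage Runge-Kutta method with real coefficients $(A,\boldsymbol b,\boldsymbol c)$, written in one-step form as $$\tilde{\boldsymbol v}_{n+1}=\tilde{\boldsymbol v}_n+h\,\Lambda_{n+1}(t_n;h)\,\tilde{\boldsymbol v}_n,\qquad \Lambda_{n+1}(t_n;h)=\frac1h(\boldsymbol b^{\intercal}\otimes\sigma_0)\,\widetilde D_n\,\bigl[I_{2s}-(A\otimes\sigma_0)\widetilde D_n\bigr]^{-1}(\mathbf 1_s\otimes\sigma_0),$$ is convergent.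
   Context: The Zakharov-Shabat problem is $\boldsymbol v_t=-i\zeta\sigma_3\boldsymbol v+U(t)\boldsymbol v$ for $\boldsymbol v=(v_1,v_2)^{\intercal}$, with $\sigma_3=\mathrm{diag}(1,-1)$, $U_{11}=U_{22}=0$, $U_{12}=q(t)$, $U_{21}=r(t)=\kappa q^*(t)$. With $\tilde{\boldsymbol v}=e^{i\sigma_3\zeta t}\boldsymbol v$ it becomes $\tilde{\boldsymbol v}_t=\widetilde U(t)\tilde{\boldsymbol v}$, where $$\widetilde U(t)=\begin{pmatrix}0&q(t)e^{2i\zeta t}\\ r(t)e^{-2i\zeta t}&0\end{pmatrix}.$$ The Runge-Kutta method has Butcher tableau $A=(a_{jk})\in\mathbb{R}^{s\times s}$, $\boldsymbol b=(b_1,\dots,b_s)^{\intercal}\in\mathbb{R}^s$, $\boldsymbol c=(c_1,\dots,c_s)$ with $0\le c_1\le\dots\le c_s\le 1$. It reads $\tilde{\boldsymbol v}_{n,j}=\tilde{\boldsymbol v}_n+h\sum_{k}a_{jk}\widetilde U(t_n+c_kh)\tilde{\boldsymbol v}_{n,k}$ for $j=1,\dots,s$, and $\tilde{\boldsymbol v}_{n+1}=\tilde{\boldsymbol v}_n+h\sum_k b_k\widetilde U(t_n+c_kh)\tilde{\boldsymbol v}_{n,k}$. Notation: $\sigma_0$ is the $2\times2$ identity, $I_{2s}$ the $2s\times 2s$ identity, $\mathbf 1_s$ the column vector of $s$ ones, $\otimes$ the Kronecker product, and $\widetilde D_n=\mathrm{diag}\bigl(h\widetilde U(t_n+c_1h),\dots,h\widetilde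 U(t_n+c_sh)\bigr)\in\mathbb{C}^{2s\times2s}$ (block diagonal). Convergence: let $[T_1,T_2]$ be a compact interval containing the support of $q$, $h=(T_2-T_1)/N$, $t_n=T_1+nh$ for $n=0,\dots,N$. The method is convergent if, for every initial vector $\tilde{\boldsymbol v}_0\in\mathbb{C}^2$, the numerical solution started from $\tilde{\boldsymbol v}_0$ is well defined for all sufficiently small $h$ and satisfies $\max_{0\le n\le N}\|\tilde{\boldsymbol v}_n-\tilde{\boldsymbol v}(t_n)\|\to0$ as $h\to0$, where $\tilde{\boldsymbol v}(t)$ is the exact solution of $\tilde{\boldsymbol v}_t=\widetilde U\tilde{\boldsymbol v}$ on $[T_1,T_2]$ with $\tilde{\boldsymbol v}(T_1)=\tilde{\boldsymbol v}_0$.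
   Formalization: The potential q is additionally assumed continuous almost everywhere; for merely bounded q the claim fails (Euler's method with ξ=0 and q the indicator of the rationals in [0,1]). Exact solutions are understood in the integral (Carathéodory) sense. *)

theory Defs
  imports "HOL-Analysis.Analysis"
begin

definition supp :: "(real \<Rightarrow> complex) \<Rightarrow> real set" where
  "supp q = closure {t. q t \<noteq> 0}"

text \<open>The coefficient matrix of the Zakharov-Shabat system in the variable
  \<open>exp(i \<sigma>\<^sub>3 \<zeta> t) v\<close>.\<close>

definition ZS_matrix ::
    "(real \<Rightarrow> complex) \<Rightarrow> (real \<Rightarrow> complex) \<Rightarrow> complex \<Rightarrow> real \<Rightarrow> complex^2^2" where
  "ZS_matrix q r \<zeta> t =
     vector [vector [0, q t * exp (2 * \<i> * \<zeta> * of_real t)],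
             vector [r t * exp (- 2 * \<i> * \<zeta> * of_real t), 0]]"

text \<open>Kronecker products. The index of a product is a pair, and \<open>col_kron\<close> and \<open>row_kron\<close> are
  the cases in which the first factor is a column vector \<open>v\<close> or a row vector \<open>v\<^sup>T\<close>; its trivial
  index of size one is dropped from the pairs.\<close>

definition kron :: "'a::times^'m^'k \<Rightarrow> 'a^'n^'l \<Rightarrow> 'a^('m \<times> 'n)^('k \<times> 'l)" where
  "kron A B = (\<chi> p q. A $ fst p $ fst q * B $ snd p $ snd q)"

definition col_kron :: "'a::times^'k \<Rightarrow> 'a^'n^'l \<Rightarrow> 'a^'n^('k \<times> 'l)" where
  "col_kron v B = (\<chi> p j. v $ fst p * B $ snd p $ j)"

definition row_kron :: "'a::times^'m \<Rightarrow> 'a^'n^'l \<Rightarrow> 'a^('m \<times> 'n)^'l" where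
  "row_kron v B = (\<chi> i q. v $ fst q * B $ i $ snd q)"

text \<open>A method with \<open>s\<close> stages is given by \<open>A\<close>, \<open>b\<close>, \<open>c\<close> over an index type \<open>'s\<close> with \<open>s\<close>
  elements. All definitions below refer to the linear system \<open>v' = U(t) v\<close> in two unknowns.\<close>

definition rk_diag ::
    "real^'s \<Rightarrow> (real \<Rightarrow> complex^2^2) \<Rightarrow> real \<Rightarrow> real \<Rightarrow> complex^('s \<times> 2)^('s \<times> 2)" where
  "rk_diag c U t h =
     (\<chi> p q. if fst p = fst q then (h *\<^sub>R U (t + c $ fst p * h)) $ snd p $ snd q else 0)"

definition rk_system ::
    "real^'s^'s \<Rightarrow> real^'s \<Rightarrow> (real \<Rightarrow> complex^2^2) \<Rightarrow> real \<Rightarrow> real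
      \<Rightarrow> complex^('s::finite \<times> 2)^('s \<times> 2)" where
  "rk_system A c U t h =
     mat 1 - kron (map_matrix of_real A) (mat 1 :: complex^2^2) ** rk_diag c U t h"

definition rk_Lambda ::
    "real^'s^'s \<Rightarrow> real^'s \<Rightarrow> real^'s \<Rightarrow> (real \<Rightarrow> complex^2^2) \<Rightarrow> real \<Rightarrow> real
      \<Rightarrow> complex^2^2" where
  "rk_Lambda A b c U t h =
     (1 / h) *\<^sub>R
       (row_kron (\<chi> j. of_real (b $ j)) (mat 1 :: complex^2^2) ** rk_diag c U t h
        ** matrix_inv (rk_system A c U t h)
        ** col_kron (\<chi> j::'s::finite. 1) (mat 1 :: complex^2^2))"

fun rk_solution ::
    "real^'s^'s \<Rightarrow> real^'s \<Rightarrow> real^'s::finite \<Rightarrow> (real \<Rightarrow> complex^2^2) \<Rightarrow> real \<Rightarrow> real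
      \<Rightarrow> complex^2 \<Rightarrow> nat \<Rightarrow> complex^2" where
  "rk_solution A b c U T1 h v0 0 = v0"
| "rk_solution A b c U T1 h v0 (Suc n) =
     (let v = rk_solution A b c U T1 h v0 n
      in v + h *\<^sub>R (rk_Lambda A b c U (T1 + of_nat n * h) h *v v))"

text \<open>The one-step form agrees with the stage form of the method.\<close>

lemma rk_one_step_form:
  fixes A :: "real^'s^'s" and b c :: "real^'s::finite" and v w :: "complex^2"
  assumes inv: "invertible (rk_system A c U t h)" and h: "h \<noteq> 0"
  shows "w = v + h *\<^sub>R (rk_Lambda A b c U t h *v v) \<longleftrightarrow>
    (\<exists>V :: 's \<Rightarrow> complex^2.
       (\<forall>j. V j = v + h *\<^sub>R (\<Sum>k\<in>UNIV. (A $ j $ k) *\<^sub>R (U (t + c $ k * h) *v V k))) \<and>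
       w = v + h *\<^sub>R (\<Sum>k\<in>UNIV. (b $ k) *\<^sub>R (U (t + c $ k * h) *v V k)))"
proof -
  define M where "M = rk_system A c U t h"
  define E where "E = col_kron (\<chi> j::'s. 1) (mat 1 :: complex^2^2)"
  define R where "R = row_kron (\<chi> j. of_real (b $ j)) (mat 1 :: complex^2^2)"
  define D where "D = rk_diag c U t h"
  define vec_of :: "('s \<Rightarrow> complex^2) \<Rightarrow> complex^('s \<times> 2)"
    where "vec_of V = (\<chi> p. V (fst p) $ snd p)" for V
  have surj: "\<exists>V. W = vec_of V" for W
    by (rule exI[of _ "\<lambda>j. \<chi> i. W $ (j, i)"]) (simp add: vec_of_def vec_eq_iff)
  have pairs: "(\<Sum>p\<in>UNIV. f p) = (\<Sum>j\<in>UNIV. \<Sum>i\<in>UNIV. f (j, i))" for f :: "'s \<times> 2 \<Rightarrow> complex"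
    by (simp add: sum.cartesian_product flip: UNIV_Times_UNIV)
  have Dv: "D *v vec_of V = vec_of (\<lambda>k. h *\<^sub>R (U (t + c $ k * h) *v V k))" for V
    by (simp add: D_def rk_diag_def vec_of_def vec_eq_iff matrix_vector_mult_def pairs
        if_distrib[of "\<lambda>x. x * _"] sum.delta scaleR_sum_right cong: if_cong)
       (simp add: if_distrib if_distribR sum.If_cases sum.swap[of _ "UNIV::2 set"] sum.delta cong: if_cong)
  have kv: "kron (map_matrix of_real A) (mat 1 :: complex^2^2) *v vec_of G
      = vec_of (\<lambda>j. \<Sum>k\<in>UNIV. (A $ j $ k) *\<^sub>R G k)" for G
    by (simp add: kron_def mat_def vec_of_def vec_eq_iff matrix_vector_mult_def pairs scaleR_conv_of_real[where 'a=complex]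
        if_distrib[of "\<lambda>x. x * _"] if_distrib[of "\<lambda>x. _ * x"] sum.delta cong: if_cong)
  have Rv: "R *v vec_of G = (\<Sum>k\<in>UNIV. (b $ k) *\<^sub>R G k)" for G
    by (simp add: R_def row_kron_def mat_def vec_of_def vec_eq_iff matrix_vector_mult_def pairs
        scaleR_conv_of_real[where 'a=complex]
        if_distrib[of "\<lambda>x. x * _"] if_distrib[of "\<lambda>x. _ * x"] sum.delta cong: if_cong)
  have Ev: "E *v v = vec_of (\<lambda>_. v)"
    by (simp add: E_def col_kron_def mat_def vec_of_def vec_eq_iff matrix_vector_mult_def
        if_distrib[of "\<lambda>x. x * _"] sum.delta cong: if_cong)
  have vec_of_eq: "vec_of V = vec_of W \<longleftrightarrow> V = W" for V W
    by (auto simp: vec_of_def vec_eq_iff fun_eq_iff)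
  have Mv: "M *v vec_of V = E *v v \<longleftrightarrow>
      (\<forall>j. V j = v + h *\<^sub>R (\<Sum>k\<in>UNIV. (A $ j $ k) *\<^sub>R (U (t + c $ k * h) *v V k)))" for V
  proof -
    have "M *v vec_of V = vec_of V - kron (map_matrix of_real A) (mat 1) *v (D *v vec_of V)"
      by (simp add: M_def rk_system_def D_def matrix_vector_mult_diff_rdistrib matrix_vector_mul_assoc)
    also have "\<dots> = vec_of (\<lambda>j. V j - h *\<^sub>R (\<Sum>k\<in>UNIV. (A $ j $ k) *\<^sub>R (U (t + c $ k * h) *v V k)))"
      unfolding Dv kv by (simp add: vec_of_def vec_eq_iff scaleR_sum_right mult.commute)
    finally have eq: "M *v vec_of V = \<dots>" .
    show ?thesis
      unfolding eq Ev vec_of_eq fun_eq_iff by (simp add: diff_eq_eq)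
  qed
  have MI: "M ** matrix_inv M = mat 1" "matrix_inv M ** M = mat 1"
    using someI_ex[OF inv[unfolded invertible_def]] by (simp_all add: M_def matrix_inv_def)
  have sol: "M *v W = E *v v \<longleftrightarrow> W = matrix_inv M *v (E *v v)" for W
  proof
    assume "M *v W = E *v v"
    then have "matrix_inv M *v (E *v v) = (matrix_inv M ** M) *v W"
      by (simp flip: matrix_vector_mul_assoc)
    then show "W = matrix_inv M *v (E *v v)"
      by (simp add: MI)
  next
    assume "W = matrix_inv M *v (E *v v)"
    then have "M *v W = (M ** matrix_inv M) *v (E *v v)"
      by (simp flip: matrix_vector_mul_assoc)
    then show "M *v W = E *v v"
      by (simp add: MI)
  qed
  have scale: "(a *\<^sub>R L) *v v = a *\<^sub>R (L *v v)" for a and L :: "complex^2^2"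
    by (simp add: vec_eq_iff matrix_vector_mult_def scaleR_sum_right)
  have step: "h *\<^sub>R (rk_Lambda A b c U t h *v v) = R *v (D *v (matrix_inv M *v (E *v v)))"
    using h unfolding rk_Lambda_def scale
    by (simp add: R_def D_def M_def E_def matrix_vector_mul_assoc matrix_mul_assoc)
  have out: "R *v (D *v vec_of V) = h *\<^sub>R (\<Sum>k\<in>UNIV. (b $ k) *\<^sub>R (U (t + c $ k * h) *v V k))" for V
    unfolding Dv Rv by (simp add: scaleR_sum_right mult.commute)
  obtain V0 where V0: "matrix_inv M *v (E *v v) = vec_of V0"
    using surj by blast
  have "M *v vec_of V = E *v v \<longleftrightarrow> V = V0" for V
    unfolding sol V0 vec_of_eq ..
  then show ?thesis
    unfolding step V0 out by (simp add: Mv[symmetric])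
qed

text \<open>\<open>U\<close> need not be continuous, so a solution of \<open>v' = U(t) v\<close> on \<open>[T1, T2]\<close> is a solution of
  the integral equation, that is, an absolutely continuous function satisfying the differential
  equation almost everywhere.\<close>

definition exact_solution ::
    "(real \<Rightarrow> complex^2^2) \<Rightarrow> real \<Rightarrow> real \<Rightarrow> complex^2 \<Rightarrow> (real \<Rightarrow> complex^2) \<Rightarrow> bool" where
  "exact_solution U T1 T2 v0 v \<longleftrightarrow>
     (\<lambda>s. U s *v v s) absolutely_integrable_on {T1..T2} \<and>
     (\<forall>t\<in>{T1..T2}. v t = v0 + integral {T1..t} (\<lambda>s. U s *v v s))"

definition rk_well_defined ::
    "real^'s^'s \<Rightarrow> real^'s::finite \<Rightarrow> (real \<Rightarrow> complex^2^2) \<Rightarrow> real \<Rightarrow> real \<Rightarrow> nat \<Rightarrow> bool" where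
  "rk_well_defined A c U T1 T2 N \<longleftrightarrow>
     (let h = (T2 - T1) / of_nat N
      in \<forall>n<N. invertible (rk_system A c U (T1 + of_nat n * h) h))"

definition rk_error ::
    "real^'s^'s \<Rightarrow> real^'s \<Rightarrow> real^'s::finite \<Rightarrow> (real \<Rightarrow> complex^2^2) \<Rightarrow> real \<Rightarrow> real
      \<Rightarrow> complex^2 \<Rightarrow> (real \<Rightarrow> complex^2) \<Rightarrow> nat \<Rightarrow> real" where
  "rk_error A b c U T1 T2 v0 v N =
     (let h = (T2 - T1) / of_nat N
      in MAX n\<in>{0..N}. norm (rk_solution A b c U T1 h v0 n - v (T1 + of_nat n * h)))"

text \<open>That the exact solution exists is part of the definition; its uniqueness on \<open>[T1, T2]\<close>
  follows, because every exact solution is a limit of the same numerical solutions.\<close>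

definition rk_convergent ::
    "real^'s^'s \<Rightarrow> real^'s \<Rightarrow> real^'s::finite \<Rightarrow> (real \<Rightarrow> complex^2^2) \<Rightarrow> real \<Rightarrow> real \<Rightarrow> bool" where
  "rk_convergent A b c U T1 T2 \<longleftrightarrow>
     (\<forall>v0.
        (\<forall>\<^sub>F N in sequentially. rk_well_defined A c U T1 T2 N) \<and>
        (\<exists>v. exact_solution U T1 T2 v0 v) \<and>
        (\<forall>v. exact_solution U T1 T2 v0 v \<longrightarrow> (rk_error A b c U T1 T2 v0 v \<longlonglongrightarrow> 0)))"

end

theory Submission
  imports Defs
begin

text \<open>For real \<open>\<xi>\<close> the exponentials in the coefficient matrix \<open>U\<close> have modulus one, so \<open>U\<close> is bounded
  because \<open>q\<close> is, and it is continuous wherever \<open>q\<close> is. Convergence holds for every linear system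
  \<open>v' = U(t) v\<close> in two unknowns whose matrix is bounded, say by \<open>M\<close>, and continuous almost
  everywhere. This is \<open>rk_convergent_bounded_ae_continuous\<close>, and it is an instance
  of the principle that a stable and consistent one-step method converges.

  Stability comes from the boundedness of \<open>U\<close> alone. Once \<open>h M \<Sum>\<bar>a\<^sub>j\<^sub>k\<bar> \<le> 1/2\<close>, the stage equations are
  a contraction (\<open>rk_stage_bound\<close>): they are uniquely solvable, which is the invertibility of the
  system matrix, and one step changes a vector by \<open>O(h)\<close> relative to its size (\<open>rk_step_bounds\<close>).
  The errors of single steps are therefore amplified by at most a factor \<open>exp(const (T2 - T1))\<close>
  (\<open>discrete_gronwall\<close>).

  Consistency cannot be read off a Taylor expansion, since the exact solution need not be
  differentiable everywhere. It solves the integral equation and is Lipschitz, and up to \<open>O(h\<^sup>2)\<close>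
  the error of one step is the error of the quadrature formula with weights \<open>b\<close> and nodes
  \<open>t\<^sub>n + c\<^sub>k h\<close> for the integral of \<open>U\<close> (\<open>rk_truncation_error\<close>); as the weights have sum one, this
  is at most a bound of the solution times \<open>\<Sum>\<bar>b\<^sub>k\<bar> \<integral>\<parallel>U(s) - U(t\<^sub>n + c\<^sub>k h)\<parallel> ds\<close>. A single such term is merely \<open>O(h)\<close>, which would
  not suffice, but the sum of all of them is the integral over \<open>[T1, T2]\<close> of the difference between
  \<open>U\<close> and a step function sampling \<open>U\<close> near \<open>s\<close>. That integral tends to \<open>0\<close> by dominated convergence,
  because \<open>U\<close> is bounded and almost every point is a point of continuity
  (\<open>integral_rk_node_diff_tendsto_0\<close>); this is the argument behind the Lebesgue criterion for
  Riemann integrability.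

  The exact solution is constructed as a Neumann series (\<open>exact_solution_exists\<close>).\<close>

section \<open>Matrix-vector products\<close>

text \<open>Cauchy-Schwarz in every row: the norm of a matrix is its Frobenius norm.\<close>

lemma norm_matrix_vector_mult_le:
  fixes A :: "complex^'n^'m" and x :: "complex^'n"
  shows "norm (A *v x) \<le> norm A * norm x"
proof -
  have row: "norm ((A *v x) $ i) \<le> norm (A $ i) * norm x" for i
  proof -
    have "norm ((A *v x) $ i) \<le> (\<Sum>j\<in>UNIV. \<bar>norm (A $ i $ j)\<bar> * \<bar>norm (x $ j)\<bar>)"
      by (simp add: matrix_vector_mult_def norm_mult sum_norm_le)
    also have "\<dots> \<le> norm (A $ i) * norm x"
      unfolding norm_vec_def by (rule L2_set_mult_ineq)
    finally show ?thesis .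
  qed
  have "norm (A *v x) \<le> L2_set (\<lambda>i. norm (A $ i) * norm x) UNIV"
    unfolding norm_vec_def[of "A *v x"] by (rule L2_set_mono) (auto simp: row)
  also have "\<dots> = norm A * norm x"
    unfolding norm_vec_def[of A] by (simp add: L2_set_left_distrib)
  finally show ?thesis .
qed

lemma norm_matrix_vector_mult_bound:
  fixes A :: "complex^'n^'m" and x :: "complex^'n"
  assumes "norm A \<le> M" "norm x \<le> K"
  shows "norm (A *v x) \<le> M * K"
  using norm_matrix_vector_mult_le[of A x] mult_mono[OF assms order_trans[OF norm_ge_zero assms(1)] norm_ge_zero]
  by (rule order_trans)

interpretation mv: bounded_bilinear
  "(*v) :: complex^'n^'m \<Rightarrow> complex^'n \<Rightarrow> complex^'m"
proof (standard, goal_cases)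
  case 5
  then show ?case
    by (intro exI[of _ 1]) (simp add: norm_matrix_vector_mult_le)
qed (simp_all add: matrix_vector_mult_def vec_eq_iff sum.distrib algebra_simps scaleR_sum_right)

section \<open>Riemann sums of bounded, almost everywhere continuous functions\<close>

text \<open>Off a negligible set the function is continuous, hence measurable, and a bounded measurable
  function on a compact interval is integrable.\<close>

lemma absolutely_integrable_bounded_ae_continuous:
  fixes g :: "real \<Rightarrow> 'a::euclidean_space"
  assumes cont: "continuous_on ({a..b} - Z) g" and Z: "negligible Z"
    and bound: "\<And>t. t \<in> {a..b} \<Longrightarrow> norm (g t) \<le> K"
  shows "g absolutely_integrable_on {a..b}"
proof -
  have "Z \<in> sets lebesgue"
    using Z by (simp add: negligible_iff_null_sets null_setsD2)
  then have S: "{a..b} - Z \<in> sets lebesgue"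
    by (intro sets.Diff) auto
  have K: "(\<lambda>_. K) integrable_on ({a..b} - Z)"
    by (rule integrable_spike_set[of _ "{a..b}"]) (auto intro: negligible_subset[OF Z])
  have "g absolutely_integrable_on ({a..b} - Z)"
    using continuous_imp_measurable_on_sets_lebesgue[OF cont S] S K
    by (rule measurable_bounded_by_integrable_imp_absolutely_integrable) (simp add: bound)
  then show ?thesis
    by (rule absolutely_integrable_spike_set) (auto intro: negligible_subset[OF Z])
qed

text \<open>The stage times \<open>t\<^sub>n + \<gamma> h\<close> of all steps, gathered into one function of \<open>s\<close>: the floor
  is the number \<open>n\<close> of the step whose interval contains \<open>s\<close>. With it, a sum of integrals over the
  single steps becomes one integral over the whole interval, to which dominated convergence
  applies.\<close>

definition rk_node :: "real \<Rightarrow> real \<Rightarrow> real \<Rightarrow> real \<Rightarrow> real" where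
  "rk_node T1 h \<gamma> s = T1 + (of_int \<lfloor>(s - T1) / h\<rfloor> + \<gamma>) * h"

lemma rk_node_eq:
  assumes "h > 0" "T1 + of_nat n * h \<le> s" "s < T1 + of_nat (Suc n) * h"
  shows "rk_node T1 h \<gamma> s = T1 + of_nat n * h + \<gamma> * h"
proof -
  have "\<lfloor>(s - T1) / h\<rfloor> = int n"
    using assms by (intro floor_unique) (auto simp: field_simps)
  then show ?thesis
    by (simp add: rk_node_def algebra_simps)
qed

lemma rk_node_dist:
  assumes "h > 0"
  shows "\<bar>rk_node T1 h \<gamma> s - s\<bar> \<le> (1 + \<bar>\<gamma>\<bar>) * h"
proof -
  define x where "x = (s - T1) / h"
  have s: "s = T1 + x * h"
    using assms by (simp add: x_def)
  have "rk_node T1 h \<gamma> s - s = ((of_int \<lfloor>x\<rfloor> - x) + \<gamma>) * h"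
    unfolding rk_node_def x_def[symmetric] using s by (simp add: algebra_simps)
  then have "\<bar>rk_node T1 h \<gamma> s - s\<bar> = \<bar>(of_int \<lfloor>x\<rfloor> - x) + \<gamma>\<bar> * h"
    using assms by (simp add: abs_mult)
  also have "\<dots> \<le> (1 + \<bar>\<gamma>\<bar>) * h"
    using assms by (intro mult_right_mono) linarith+
  finally show ?thesis .
qed

text \<open>A step function is continuous away from the grid. Since the grid is countable, the sampled
  function falls under \<open>absolutely_integrable_bounded_ae_continuous\<close>.\<close>

lemma continuous_on_rk_node:
  assumes "h > 0"
  shows "continuous_on (- range (\<lambda>m::int. T1 + of_int m * h)) (\<lambda>s. f (rk_node T1 h \<gamma> s))"
proof (rule continuous_at_imp_continuous_on, safe)
  fix s assume s: "s \<notin> range (\<lambda>m::int. T1 + of_int m * h)"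
  have nint: "(s - T1) / h \<notin> \<int>"
  proof
    assume "(s - T1) / h \<in> \<int>"
    then obtain m where "(s - T1) / h = of_int m"
      by (auto elim: Ints_cases)
    then have "s = T1 + of_int m * h"
      using assms by (simp add: field_simps)
    with s show False by blast
  qed
  have "isCont (\<lambda>s. (s - T1) / h) s"
    using assms by (intro continuous_intros) auto
  then have "((\<lambda>s. (s - T1) / h) \<longlongrightarrow> (s - T1) / h) (at s)"
    by (simp add: isCont_def)
  then have "\<forall>\<^sub>F x in at s. \<lfloor>(x - T1) / h\<rfloor> = \<lfloor>(s - T1) / h\<rfloor>"
    using nint by (rule eventually_floor_eq)
  then have "\<forall>\<^sub>F x in at s. f (rk_node T1 h \<gamma> x) = f (rk_node T1 h \<gamma> s)"
    by eventually_elim (simp add: rk_node_def)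
  then show "isCont (\<lambda>s. f (rk_node T1 h \<gamma> s)) s"
    unfolding isCont_def by (rule tendsto_eventually)
qed

lemma absolutely_integrable_rk_node_diff:
  fixes U :: "real \<Rightarrow> 'a::euclidean_space"
  assumes "h > 0" and M: "\<And>t. norm (U t) \<le> M" and ae: "negligible {t. \<not> isCont U t}"
  shows "(\<lambda>s. norm (U s - U (rk_node T1 h \<gamma> s))) absolutely_integrable_on {a..b}"
proof (rule absolutely_integrable_bounded_ae_continuous)
  let ?Z = "{t. \<not> isCont U t} \<union> range (\<lambda>m::int. T1 + of_int m * h)"
  show "negligible ?Z"
    using ae
    by (intro negligible_Un) (auto simp: negligible_iff_null_sets intro!: null_sets_completionI countable_imp_null_set_lborel)
  have "continuous_on ({a..b} - ?Z) U"
    by (rule continuous_at_imp_continuous_on) auto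
  moreover have "continuous_on ({a..b} - ?Z) (\<lambda>s. U (rk_node T1 h \<gamma> s))"
    by (rule continuous_on_subset[OF continuous_on_rk_node[OF \<open>h > 0\<close>]]) auto
  ultimately show "continuous_on ({a..b} - ?Z) (\<lambda>s. norm (U s - U (rk_node T1 h \<gamma> s)))"
    by (intro continuous_intros)
  show "norm (norm (U s - U (rk_node T1 h \<gamma> s))) \<le> 2 * M" for s
    using norm_triangle_ineq4[of "U s" "U (rk_node T1 h \<gamma> s)"] M[of s] M[of "rk_node T1 h \<gamma> s"] by simp
qed

text \<open>The quadrature errors vanish in the limit, without a rate. A node is at distance \<open>O(h)\<close> from
  \<open>s\<close>, so the integrand tends to \<open>0\<close> at every continuity point of \<open>U\<close>, and it is
  dominated by \<open>2 M\<close>.\<close>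

lemma integral_rk_node_diff_tendsto_0:
  fixes U :: "real \<Rightarrow> 'a::euclidean_space"
  assumes M: "\<And>t. norm (U t) \<le> M" and ae: "negligible {t. \<not> isCont U t}" and T: "T1 < T2"
  shows "(\<lambda>N. integral {T1..T2} (\<lambda>s. norm (U s - U (rk_node T1 ((T2 - T1) / of_nat N) \<gamma> s))))
           \<longlonglongrightarrow> 0"
proof -
  define Z where "Z = {t. \<not> isCont U t}"
  define S where "S = {T1..T2} - Z"
  \<comment> \<open>The index is shifted by one so that every step size is positive.\<close>
  define h where "h N = (T2 - T1) / of_nat (Suc N)" for N
  define f where "f N s = norm (U s - U (rk_node T1 (h N) \<gamma> s))" for N s
  have h: "h N > 0" for N
    using T by (simp add: h_def)
  have h0: "h \<longlonglongrightarrow> 0"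
    unfolding h_def by (rule LIMSEQ_Suc[OF lim_const_over_n])
  have spike: "integral {T1..T2} g = integral S g" for g :: "real \<Rightarrow> real"
    by (rule integral_spike_set)
       (auto simp: S_def Z_def intro: negligible_subset[OF ae])
  have fS: "f N integrable_on S" for N
  proof (rule integrable_spike_set[of _ "{T1..T2}"])
    show "f N integrable_on {T1..T2}"
      unfolding f_def
      by (rule set_lebesgue_integral_eq_integral(1)[OF absolutely_integrable_rk_node_diff[OF h M ae]])
  qed (auto simp: S_def Z_def intro: negligible_subset[OF ae])
  have KS: "(\<lambda>_. 2 * M) integrable_on S"
    by (rule integrable_spike_set[of _ "{T1..T2}"])
       (auto simp: S_def Z_def intro: negligible_subset[OF ae])
  have "(\<lambda>N. integral S (f N)) \<longlonglongrightarrow> integral S (\<lambda>_. 0)"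
  proof (rule dominated_convergence(2)[OF fS KS])
    fix N s
    show "norm (f N s) \<le> 2 * M"
      using norm_triangle_ineq4[of "U s" "U (rk_node T1 (h N) \<gamma> s)"]
        M[of s] M[of "rk_node T1 (h N) \<gamma> s"] by (simp add: f_def)
  next
    fix s assume "s \<in> S"
    then have cont: "isCont U s"
      by (simp add: S_def Z_def)
    have "(\<lambda>N. rk_node T1 (h N) \<gamma> s - s) \<longlonglongrightarrow> 0"
    proof (rule Lim_null_comparison)
      show "\<forall>\<^sub>F N in sequentially. norm (rk_node T1 (h N) \<gamma> s - s) \<le> (1 + \<bar>\<gamma>\<bar>) * h N"
        using rk_node_dist[OF h] by simp
      show "(\<lambda>N. (1 + \<bar>\<gamma>\<bar>) * h N) \<longlonglongrightarrow> 0"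
        using tendsto_mult_left[OF h0, of "1 + \<bar>\<gamma>\<bar>"] by simp
    qed
    then have "(\<lambda>N. rk_node T1 (h N) \<gamma> s) \<longlonglongrightarrow> s"
      by (simp add: LIM_zero_iff)
    then have "(\<lambda>N. U (rk_node T1 (h N) \<gamma> s)) \<longlonglongrightarrow> U s"
      by (rule isCont_tendsto_compose[OF cont])
    from tendsto_norm[OF tendsto_diff[OF tendsto_const[of "U s"] this]]
    show "(\<lambda>N. f N s) \<longlonglongrightarrow> 0"
      by (simp add: f_def)
  qed
  then have "(\<lambda>N. integral {T1..T2} (f N)) \<longlonglongrightarrow> 0"
    by (simp add: spike)
  then show ?thesis
    unfolding f_def h_def by (rule LIMSEQ_imp_Suc)
qed

section \<open>The stage equations for a small step size\<close>

text \<open>The system matrix maps a stage vector to the residual of the homogeneous part of the stage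
  equations. Its kernel therefore consists of the stages of the method started at \<open>0\<close>, which makes
  invertibility a case of the a priori bound \<open>rk_stage_bound\<close>.\<close>

lemma rk_system_mult_component:
  fixes A :: "real^'s^'s" and c :: "real^'s::finite"
  shows "(rk_system A c U t h *v W) $ (j, i) =
    W $ (j, i) - (h *\<^sub>R (\<Sum>k\<in>UNIV. (A $ j $ k) *\<^sub>R (U (t + c $ k * h) *v (\<chi> l. W $ (k, l))))) $ i"
proof -
  have entry: "(kron (map_matrix of_real A) (mat 1 :: complex^2^2) ** rk_diag c U t h) $ (j, i) $ (k, l)
      = of_real (A $ j $ k) * (h *\<^sub>R U (t + c $ k * h)) $ i $ l" for k l
  proof -
    have "(kron (map_matrix of_real A) (mat 1 :: complex^2^2) ** rk_diag c U t h) $ (j, i) $ (k, l)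
      = (\<Sum>k'\<in>UNIV. \<Sum>l'\<in>UNIV. if k' = k then if i = l' then
           of_real (A $ j $ k') * (h *\<^sub>R U (t + c $ k * h)) $ l' $ l else 0 else 0)"
      by (simp add: matrix_matrix_mult_def kron_def mat_def rk_diag_def sum.cartesian_product
          flip: UNIV_Times_UNIV) (rule sum.cong, auto)
    also have "\<dots> = (\<Sum>k'\<in>UNIV. if k' = k then
           of_real (A $ j $ k') * (h *\<^sub>R U (t + c $ k * h)) $ i $ l else 0)"
      by (rule sum.cong) (auto simp: sum.delta)
    finally show ?thesis
      by (simp add: sum.delta)
  qed
  have "(rk_system A c U t h *v W) $ (j, i) = W $ (j, i) -
      (\<Sum>k\<in>UNIV. \<Sum>l\<in>UNIV. of_real (A $ j $ k) * (h *\<^sub>R U (t + c $ k * h)) $ i $ l * W $ (k, l))"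
    unfolding rk_system_def matrix_vector_mult_diff_rdistrib matrix_vector_mul_lid vector_minus_component
    unfolding matrix_vector_mult_def entry[symmetric] sum.cartesian_product UNIV_Times_UNIV
    by (simp add: split_def)
  then show ?thesis
    by (simp add: matrix_vector_mult_def scaleR_sum_right sum_distrib_left scaleR_conv_of_real[where 'a=complex] mult_ac)
qed

text \<open>Let \<open>m\<close> be the largest norm of a stage. Every stage differs from \<open>v\<close> by at most \<open>h M \<alpha> m\<close>,
  where \<open>\<alpha>\<close> is the sum of the \<open>\<bar>a\<^sub>j\<^sub>k\<bar>\<close>. For \<open>h M \<alpha> \<le> 1/2\<close> this gives \<open>m \<le> \<parallel>v\<parallel> + m/2\<close>, which is the
  first claim; inserting it into the estimate of the difference gives the second one.\<close>

lemma rk_stage_bound: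
  fixes A :: "real^'s^'s" and c :: "real^'s::finite" and V :: "'s \<Rightarrow> complex^2"
  assumes stage: "\<And>j. V j = v + h *\<^sub>R (\<Sum>k\<in>UNIV. (A $ j $ k) *\<^sub>R (U (t + c $ k * h) *v V k))"
    and M: "\<And>t. norm (U t) \<le> M" and h: "0 \<le> h"
    and small: "h * M * (\<Sum>j\<in>UNIV. \<Sum>k\<in>UNIV. \<bar>A $ j $ k\<bar>) \<le> 1 / 2"
  shows "norm (V j) \<le> 2 * norm v"
    and "norm (V j - v) \<le> 2 * h * M * (\<Sum>j\<in>UNIV. \<Sum>k\<in>UNIV. \<bar>A $ j $ k\<bar>) * norm v"
proof -
  define \<alpha> where "\<alpha> = (\<Sum>j\<in>UNIV. \<Sum>k\<in>UNIV. \<bar>A $ j $ k\<bar>)"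
  define m where "m = Max (range (\<lambda>j. norm (V j)))"
  have m: "norm (V j) \<le> m" for j
    unfolding m_def by (rule Max_ge) auto
  have M0: "0 \<le> M"
    using M[of 0] norm_ge_zero order_trans by blast
  have m0: "0 \<le> m"
    using m norm_ge_zero order_trans by blast
  have dev: "norm (V j - v) \<le> h * M * \<alpha> * m" for j
  proof -
    have "V j - v = h *\<^sub>R (\<Sum>k\<in>UNIV. (A $ j $ k) *\<^sub>R (U (t + c $ k * h) *v V k))"
      by (subst stage) simp
    then have "norm (V j - v) = h * norm (\<Sum>k\<in>UNIV. (A $ j $ k) *\<^sub>R (U (t + c $ k * h) *v V k))"
      using h by simp
    also have "\<dots> \<le> h * (\<Sum>k\<in>UNIV. \<bar>A $ j $ k\<bar> * (M * m))"
    proof (rule mult_left_mono[OF sum_norm_le h])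
      fix k
      have "norm (U (t + c $ k * h) *v V k) \<le> M * m"
        by (rule norm_matrix_vector_mult_bound[OF M m])
      then show "norm ((A $ j $ k) *\<^sub>R (U (t + c $ k * h) *v V k)) \<le> \<bar>A $ j $ k\<bar> * (M * m)"
        by (simp add: mult_left_mono)
    qed
    also have "\<dots> = (\<Sum>k\<in>UNIV. \<bar>A $ j $ k\<bar>) * (h * M * m)"
      by (simp add: sum_distrib_right sum_distrib_left mult_ac)
    also have "\<dots> \<le> \<alpha> * (h * M * m)"
      unfolding \<alpha>_def using M0 m0 h
      by (intro mult_right_mono member_le_sum) (auto intro: sum_nonneg)
    finally show ?thesis
      by (simp add: mult_ac)
  qed
  have "m \<in> range (\<lambda>j. norm (V j))"
    unfolding m_def by (rule Max_in) auto
  then obtain j0 where "m = norm (V j0)"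
    by blast
  then have "m \<le> norm v + norm (V j0 - v)"
    by (simp add: norm_triangle_sub)
  also have "norm (V j0 - v) \<le> h * M * \<alpha> * m"
    by (rule dev)
  also have "h * M * \<alpha> * m \<le> 1 / 2 * m"
    using small m0 unfolding \<alpha>_def by (rule mult_right_mono)
  finally have m2: "m \<le> 2 * norm v"
    by simp
  show "norm (V j) \<le> 2 * norm v"
    using m m2 order_trans by blast
  have "0 \<le> h * M * \<alpha>"
    using h M0 by (auto simp: \<alpha>_def intro!: mult_nonneg_nonneg sum_nonneg)
  then have "h * M * \<alpha> * m \<le> h * M * \<alpha> * (2 * norm v)"
    using m2 by (rule mult_left_mono[rotated])
  then show "norm (V j - v) \<le> 2 * h * M * (\<Sum>j\<in>UNIV. \<Sum>k\<in>UNIV. \<bar>A $ j $ k\<bar>) * norm v"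
    using dev[of j] unfolding \<alpha>_def by (simp add: mult_ac)
qed

lemma rk_system_invertible:
  fixes A :: "real^'s^'s" and c :: "real^'s::finite"
  assumes M: "\<And>t. norm (U t) \<le> M" and h: "0 \<le> h"
    and small: "h * M * (\<Sum>j\<in>UNIV. \<Sum>k\<in>UNIV. \<bar>A $ j $ k\<bar>) \<le> 1 / 2"
  shows "invertible (rk_system A c U t h)"
  unfolding invertible_left_inverse matrix_left_invertible_ker
proof safe
  fix W assume W: "rk_system A c U t h *v W = 0"
  define V :: "'s \<Rightarrow> complex^2" where "V k = (\<chi> l. W $ (k, l))" for k
  have "V j = 0 + h *\<^sub>R (\<Sum>k\<in>UNIV. (A $ j $ k) *\<^sub>R (U (t + c $ k * h) *v V k))" for j
    unfolding vec_eq_iff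
    using rk_system_mult_component[of A c U t h W j] W by (simp add: V_def)
  from rk_stage_bound(1)[where v = 0, OF this M h small] have "V j = 0" for j
    by simp
  then show "W = 0"
    by (auto simp: V_def vec_eq_iff)
qed

text \<open>The first bound, being linear in \<open>v\<close>, gives stability; the second one replaces the stages
  by \<open>v\<close> and reduces consistency to the quadrature formula with weights \<open>b\<close> and nodes \<open>c\<close>.\<close>

lemma rk_step_bounds:
  fixes A :: "real^'s^'s" and b c :: "real^'s::finite" and v :: "complex^2"
  assumes M: "\<And>t. norm (U t) \<le> M" and h: "0 < h"
    and small: "h * M * (\<Sum>j\<in>UNIV. \<Sum>k\<in>UNIV. \<bar>A $ j $ k\<bar>) \<le> 1 / 2"
  shows "norm (h *\<^sub>R (rk_Lambda A b c U t h *v v)) \<le> 2 * h * M * (\<Sum>k\<in>UNIV. \<bar>b $ k\<bar>) * norm v"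
    and "norm (h *\<^sub>R (rk_Lambda A b c U t h *v v)
            - h *\<^sub>R (\<Sum>k\<in>UNIV. (b $ k) *\<^sub>R (U (t + c $ k * h) *v v)))
          \<le> 2 * h\<^sup>2 * M\<^sup>2 * (\<Sum>j\<in>UNIV. \<Sum>k\<in>UNIV. \<bar>A $ j $ k\<bar>) * (\<Sum>k\<in>UNIV. \<bar>b $ k\<bar>) * norm v"
proof -
  define w where "w = v + h *\<^sub>R (rk_Lambda A b c U t h *v v)"
  have "invertible (rk_system A c U t h)"
    by (rule rk_system_invertible[OF M less_imp_le[OF h] small])
  then have "\<exists>V. (\<forall>j. V j = v + h *\<^sub>R (\<Sum>k\<in>UNIV. (A $ j $ k) *\<^sub>R (U (t + c $ k * h) *v V k))) \<and>
      w = v + h *\<^sub>R (\<Sum>k\<in>UNIV. (b $ k) *\<^sub>R (U (t + c $ k * h) *v V k))"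
    using rk_one_step_form h w_def by blast
  then obtain V where stage: "\<And>j. V j = v + h *\<^sub>R (\<Sum>k\<in>UNIV. (A $ j $ k) *\<^sub>R (U (t + c $ k * h) *v V k))"
    and w: "w = v + h *\<^sub>R (\<Sum>k\<in>UNIV. (b $ k) *\<^sub>R (U (t + c $ k * h) *v V k))"
    by blast
  have step: "h *\<^sub>R (rk_Lambda A b c U t h *v v) = h *\<^sub>R (\<Sum>k\<in>UNIV. (b $ k) *\<^sub>R (U (t + c $ k * h) *v V k))"
    using w unfolding w_def by (rule add_left_imp_eq)
  note bounds = rk_stage_bound[OF stage M less_imp_le[OF h] small]
  have quad: "norm (h *\<^sub>R (\<Sum>k\<in>UNIV. (b $ k) *\<^sub>R (U (t + c $ k * h) *v x k))) \<le> h * M * (\<Sum>k\<in>UNIV. \<bar>b $ k\<bar>) * K"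
    if x: "\<And>k. norm (x k) \<le> K" for x K
  proof -
    have "norm (\<Sum>k\<in>UNIV. (b $ k) *\<^sub>R (U (t + c $ k * h) *v x k)) \<le> (\<Sum>k\<in>UNIV. \<bar>b $ k\<bar> * (M * K))"
    proof (rule sum_norm_le)
      fix k
      have "norm (U (t + c $ k * h) *v x k) \<le> M * K"
        by (rule norm_matrix_vector_mult_bound[OF M x])
      then show "norm ((b $ k) *\<^sub>R (U (t + c $ k * h) *v x k)) \<le> \<bar>b $ k\<bar> * (M * K)"
        by (simp add: mult_left_mono)
    qed
    from mult_left_mono[OF this less_imp_le[OF h]] show ?thesis
      using h by (simp add: mult_ac sum_distrib_left sum_distrib_right)
  qed
  show "norm (h *\<^sub>R (rk_Lambda A b c U t h *v v)) \<le> 2 * h * M * (\<Sum>k\<in>UNIV. \<bar>b $ k\<bar>) * norm v"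
    unfolding step using quad[of V, OF bounds(1)] by (simp add: mult_ac)
  have "h *\<^sub>R (rk_Lambda A b c U t h *v v) - h *\<^sub>R (\<Sum>k\<in>UNIV. (b $ k) *\<^sub>R (U (t + c $ k * h) *v v))
      = h *\<^sub>R (\<Sum>k\<in>UNIV. (b $ k) *\<^sub>R (U (t + c $ k * h) *v (V k - v)))"
    unfolding step by (simp add: mv.diff_right scaleR_diff_right sum_subtractf)
  then show "norm (h *\<^sub>R (rk_Lambda A b c U t h *v v)
            - h *\<^sub>R (\<Sum>k\<in>UNIV. (b $ k) *\<^sub>R (U (t + c $ k * h) *v v)))
          \<le> 2 * h\<^sup>2 * M\<^sup>2 * (\<Sum>j\<in>UNIV. \<Sum>k\<in>UNIV. \<bar>A $ j $ k\<bar>) * (\<Sum>k\<in>UNIV. \<bar>b $ k\<bar>) * norm v"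
    using quad[of "\<lambda>k. V k - v", OF bounds(2)] by (simp add: mult_ac power2_eq_square)
qed

section \<open>Exact solutions\<close>

lemma absolutely_integrable_matrix_vector_mult:
  fixes U :: "real \<Rightarrow> complex^'n^'m"
  assumes M: "\<And>t. norm (U t) \<le> M" and ae: "negligible {t. \<not> isCont U t}"
    and f: "continuous_on {a..b} f"
  shows "(\<lambda>s. U s *v f s) absolutely_integrable_on {a..b}"
proof -
  have "bounded (f ` {a..b})"
    using f compact_continuous_image compact_imp_bounded by blast
  then obtain K where "\<forall>x\<in>f ` {a..b}. norm x \<le> K"
    unfolding bounded_iff by blast
  then have K: "norm (f t) \<le> K" if "t \<in> {a..b}" for t
    using that by blast
  show ?thesis
  proof (rule absolutely_integrable_bounded_ae_continuous[OF _ ae])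
    show "continuous_on ({a..b} - {t. \<not> isCont U t}) (\<lambda>s. U s *v f s)"
      by (intro mv.continuous_on continuous_on_subset[OF f] continuous_at_imp_continuous_on) auto
    show "norm (U t *v f t) \<le> M * K" if "t \<in> {a..b}" for t
      by (rule norm_matrix_vector_mult_bound[OF M K[OF that]])
  qed
qed

text \<open>The terms of the Neumann series of the integral equation, that is, the differences of
  successive Picard iterates.\<close>

primrec neumann_term :: "(real \<Rightarrow> complex^'n^'n) \<Rightarrow> real \<Rightarrow> complex^'n \<Rightarrow> nat \<Rightarrow> real \<Rightarrow> complex^'n" where
  "neumann_term U a v0 0 = (\<lambda>t. v0)"
| "neumann_term U a v0 (Suc n) = (\<lambda>t. integral {a..t} (\<lambda>s. U s *v neumann_term U a v0 n s))"

lemma continuous_on_neumann_term: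
  fixes U :: "real \<Rightarrow> complex^'n^'n"
  assumes M: "\<And>t. norm (U t) \<le> M" and ae: "negligible {t. \<not> isCont U t}"
  shows "continuous_on {a..b} (neumann_term U a v0 n)"
proof (induction n)
  case (Suc n)
  then show ?case
    using absolutely_integrable_matrix_vector_mult[OF M ae Suc]
    by (auto intro!: indefinite_integral_continuous_1 set_lebesgue_integral_eq_integral(1))
qed simp

lemma norm_neumann_term_le:
  fixes U :: "real \<Rightarrow> complex^'n^'n"
  assumes M: "\<And>t. norm (U t) \<le> M" and ae: "negligible {t. \<not> isCont U t}" and "a \<le> t"
  shows "norm (neumann_term U a v0 n t) \<le> norm v0 * (M * (t - a)) ^ n / fact n"
  using \<open>a \<le> t\<close>
proof (induction n arbitrary: t)
  case (Suc n)
  have I: "((\<lambda>s. M * (norm v0 * (M * (s - a)) ^ n / fact n)) has_integral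
      norm v0 * (M * (t - a)) ^ Suc n / fact (Suc n) - norm v0 * (M * (a - a)) ^ Suc n / fact (Suc n)) {a..t}"
  proof (rule fundamental_theorem_of_calculus[OF Suc.prems])
    fix s
    have "((\<lambda>t. norm v0 * (M * (t - a)) ^ Suc n / fact (Suc n)) has_real_derivative
        norm v0 * (of_nat (Suc n) * (M * (s - a)) ^ n * M) / fact (Suc n)) (at s within {a..t})"
      by (auto intro!: derivative_eq_intros simp del: fact_Suc power_Suc)
    also have "norm v0 * (of_nat (Suc n) * (M * (s - a)) ^ n * M) / fact (Suc n)
        = M * (norm v0 * (M * (s - a)) ^ n / fact n)"
      by (simp add: divide_simps)
    finally show "((\<lambda>t. norm v0 * (M * (t - a)) ^ Suc n / fact (Suc n)) has_vector_derivative
        M * (norm v0 * (M * (s - a)) ^ n / fact n)) (at s within {a..t})"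
      by (simp add: has_real_derivative_iff_has_vector_derivative)
  qed
  have "norm (neumann_term U a v0 (Suc n) t) \<le> integral {a..t} (\<lambda>s. M * (norm v0 * (M * (s - a)) ^ n / fact n))"
    unfolding neumann_term.simps
  proof (rule integral_norm_bound_integral)
    show "(\<lambda>s. U s *v neumann_term U a v0 n s) integrable_on {a..t}"
      by (intro set_lebesgue_integral_eq_integral(1) absolutely_integrable_matrix_vector_mult[OF M ae]
          continuous_on_neumann_term[OF M ae])
    show "(\<lambda>s. M * (norm v0 * (M * (s - a)) ^ n / fact n)) integrable_on {a..t}"
      using I by blast
    fix s assume "s \<in> {a..t}"
    then have "norm (neumann_term U a v0 n s) \<le> norm v0 * (M * (s - a)) ^ n / fact n"
      by (intro Suc.IH) auto
    then show "norm (U s *v neumann_term U a v0 n s) \<le> M * (norm v0 * (M * (s - a)) ^ n / fact n)"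
      by (rule norm_matrix_vector_mult_bound[OF M])
  qed
  then show ?case
    using integral_unique[OF I] by simp
qed simp

text \<open>The Neumann series converges uniformly by comparison with the exponential series, and its
  partial sums satisfy the integral equation up to a shift of the index. Dominated convergence
  carries the equation to the limit.\<close>

lemma exact_solution_exists:
  assumes M: "\<And>t. norm (U t) \<le> M" and ae: "negligible {t. \<not> isCont U t}"
  shows "\<exists>v. exact_solution U T1 T2 v0 v"
proof -
  define p where "p = neumann_term U T1 v0"
  define S where "S k t = (\<Sum>n<k. p n t)" for k t
  define v where "v t = (\<Sum>n. p n t)" for t
  define B where "B n = norm v0 * (M * (T2 - T1)) ^ n / fact n" for n
  have M0: "0 \<le> M"
    using M[of 0] norm_ge_zero order_trans by blast
  have p: "norm (p n t) \<le> B n" if "t \<in> {T1..T2}" for n t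
  proof -
    have "norm (p n t) \<le> norm v0 * (M * (t - T1)) ^ n / fact n"
      unfolding p_def using that by (intro norm_neumann_term_le[OF M ae]) auto
    also have "\<dots> \<le> B n"
      unfolding B_def using that M0
      by (intro divide_right_mono mult_left_mono power_mono) auto
    finally show ?thesis .
  qed
  have B: "summable B"
    using summable_mult[OF summable_exp[of "M * (T2 - T1)"], of "norm v0"]
    by (simp add: B_def[abs_def] divide_inverse mult_ac)
  have lim: "uniform_limit {T1..T2} S v sequentially"
    unfolding S_def v_def using p B by (rule Weierstrass_m_test)
  have pc: "continuous_on {T1..T2} (p n)" for n
    unfolding p_def by (rule continuous_on_neumann_term[OF M ae])
  have Sc: "continuous_on {T1..T2} (S k)" for k
    unfolding S_def by (intro continuous_on_sum pc)
  have vc: "continuous_on {T1..T2} v"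
    by (rule uniform_limit_theorem[OF _ lim]) (auto simp: Sc)
  have int: "(\<lambda>s. U s *v f s) integrable_on {T1..t}"
    if "continuous_on {T1..T2} f" "t \<in> {T1..T2}" for f t
    using that
    by (intro set_lebesgue_integral_eq_integral(1) absolutely_integrable_matrix_vector_mult[OF M ae]
        continuous_on_subset[OF that(1)]) auto
  have "v t = v0 + integral {T1..t} (\<lambda>s. U s *v v s)" if t: "t \<in> {T1..T2}" for t
  proof (rule LIMSEQ_unique)
    show "(\<lambda>k. S (Suc k) t) \<longlonglongrightarrow> v t"
      by (rule LIMSEQ_Suc[OF tendsto_uniform_limitI[OF lim t]])
    have "S (Suc k) t = v0 + integral {T1..t} (\<lambda>s. U s *v S k s)" for k
    proof -
      have "S (Suc k) t = v0 + (\<Sum>n<k. p (Suc n) t)"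
        unfolding S_def sum.lessThan_Suc_shift by (simp add: p_def)
      also have "(\<Sum>n<k. p (Suc n) t) = integral {T1..t} (\<lambda>s. \<Sum>n<k. U s *v p n s)"
        by (subst integral_sum) (auto simp: p_def intro!: int[OF _ t] continuous_on_neumann_term[OF M ae])
      finally show ?thesis
        by (simp add: S_def mv.sum_right)
    qed
    moreover have "(\<lambda>k. integral {T1..t} (\<lambda>s. U s *v S k s)) \<longlonglongrightarrow> integral {T1..t} (\<lambda>s. U s *v v s)"
    proof (rule dominated_convergence(2)[where h = "\<lambda>_. M * suminf B"])
      show "(\<lambda>s. U s *v S k s) integrable_on {T1..t}" for k
        by (rule int[OF Sc t])
      fix s assume "s \<in> {T1..t}"
      then have s: "s \<in> {T1..T2}"
        using t by auto
      show "(\<lambda>k. U s *v S k s) \<longlonglongrightarrow> U s *v v s"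
        by (intro mv.tendsto tendsto_const tendsto_uniform_limitI[OF lim s])
      fix k
      have "norm (S k s) \<le> (\<Sum>n<k. B n)"
        unfolding S_def by (rule sum_norm_le) (rule p[OF s])
      also have "\<dots> \<le> suminf B"
        using order_trans[OF norm_ge_zero p[OF s]] by (intro sum_le_suminf[OF B]) auto
      finally show "norm (U s *v S k s) \<le> M * suminf B"
        by (rule norm_matrix_vector_mult_bound[OF M])
    qed auto
    ultimately show "(\<lambda>k. S (Suc k) t) \<longlonglongrightarrow> v0 + integral {T1..t} (\<lambda>s. U s *v v s)"
      by (simp add: tendsto_add)
  qed
  then have "exact_solution U T1 T2 v0 v"
    using absolutely_integrable_matrix_vector_mult[OF M ae vc] by (simp add: exact_solution_def)
  then show ?thesis
    by blast
qed

lemma exact_solution_integrable: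
  assumes "exact_solution U T1 T2 v0 v" "T1 \<le> s" "t \<le> T2"
  shows "(\<lambda>x. U x *v v x) integrable_on {s..t}"
proof (rule integrable_on_subinterval)
  show "(\<lambda>x. U x *v v x) integrable_on {T1..T2}"
    using assms(1) unfolding exact_solution_def by (blast intro: set_lebesgue_integral_eq_integral(1))
qed (use assms in auto)

lemma exact_solution_diff:
  assumes ex: "exact_solution U T1 T2 v0 v" and st: "T1 \<le> s" "s \<le> t" "t \<le> T2"
  shows "v t - v s = integral {s..t} (\<lambda>x. U x *v v x)"
proof -
  define I where "I x = integral {T1..x} (\<lambda>x. U x *v v x)" for x
  have "I s + integral {s..t} (\<lambda>x. U x *v v x) = I t"
    unfolding I_def
    by (rule Henstock_Kurzweil_Integration.integral_combine[OF st(1,2) exact_solution_integrable[OF ex]])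
       (use st in auto)
  moreover have "v x = v0 + I x" if "x \<in> {T1..T2}" for x
    using ex that unfolding exact_solution_def I_def by blast
  then have "v s = v0 + I s" "v t = v0 + I t"
    using st by auto
  ultimately show ?thesis
    by (metis add_diff_cancel_left add_diff_cancel_left')
qed

text \<open>Continuity is not part of the definition of an exact solution; it comes from the integral
  equation, an indefinite integral being continuous.\<close>

lemma exact_solution_bounded:
  assumes ex: "exact_solution U T1 T2 v0 v"
  shows "\<exists>B\<ge>0. \<forall>t\<in>{T1..T2}. norm (v t) \<le> B"
proof -
  have "continuous_on {T1..T2} (\<lambda>t. integral {T1..t} (\<lambda>s. U s *v v s))"
    by (rule indefinite_integral_continuous_1[OF exact_solution_integrable[OF ex order_refl order_refl]])
  then have "continuous_on {T1..T2} (\<lambda>t. v0 + integral {T1..t} (\<lambda>s. U s *v v s))"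
    by (rule continuous_on_add[OF continuous_on_const])
  moreover have "v0 + integral {T1..t} (\<lambda>s. U s *v v s) = v t" if "t \<in> {T1..T2}" for t
    using ex that unfolding exact_solution_def by (blast intro: sym)
  ultimately have "continuous_on {T1..T2} v"
    by (rule continuous_on_eq)
  then have "bounded (v ` {T1..T2})"
    using compact_continuous_image compact_imp_bounded by blast
  then obtain B where "B > 0" "\<forall>x\<in>v ` {T1..T2}. norm x \<le> B"
    unfolding bounded_pos by blast
  then show ?thesis
    by (intro exI[of _ B]) auto
qed

lemma exact_solution_lipschitz:
  assumes ex: "exact_solution U T1 T2 v0 v" and M: "\<And>t. norm (U t) \<le> M"
    and B: "\<And>t. t \<in> {T1..T2} \<Longrightarrow> norm (v t) \<le> B" and st: "T1 \<le> s" "s \<le> t" "t \<le> T2"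
  shows "norm (v t - v s) \<le> M * B * (t - s)"
proof -
  have "norm (integral {s..t} (\<lambda>x. U x *v v x)) \<le> integral {s..t} (\<lambda>_. M * B)"
  proof (rule integral_norm_bound_integral[OF exact_solution_integrable[OF ex st(1,3)]])
    fix x assume "x \<in> {s..t}"
    then have "norm (v x) \<le> B"
      using st by (intro B) auto
    then show "norm (U x *v v x) \<le> M * B"
      by (rule norm_matrix_vector_mult_bound[OF M])
  qed auto
  then show ?thesis
    using st by (simp add: exact_solution_diff[OF ex] mult_ac)
qed

section \<open>Consistency, stability and convergence\<close>

text \<open>On one step
  \<open>U(s) v(s) - \<Sum>b\<^sub>k U(t + c\<^sub>k h) v(t) = U(s) (v(s) - v(t)) + \<Sum>b\<^sub>k (U(s) - U(t + c\<^sub>k h)) v(t)\<close>,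
  because the weights have sum one. The first term is \<open>O(h)\<close> since the exact solution is
  Lipschitz, so it contributes \<open>O(h\<^sup>2)\<close> to the step; the second one is the quadrature error of
  \<open>U\<close>, for which no rate is available when \<open>U\<close> is only bounded. Replacing the stages by
  \<open>v(t)\<close> costs another \<open>O(h\<^sup>2)\<close>.\<close>

lemma rk_truncation_error:
  fixes A :: "real^'s^'s" and b c :: "real^'s::finite"
  assumes ex: "exact_solution U T1 T2 v0 v"
    and M: "\<And>t. norm (U t) \<le> M" and ae: "negligible {t. \<not> isCont U t}"
    and B: "\<And>t. t \<in> {T1..T2} \<Longrightarrow> norm (v t) \<le> B"
    and h: "0 < h" and t: "T1 \<le> t" "t + h \<le> T2"
    and small: "h * M * (\<Sum>j\<in>UNIV. \<Sum>k\<in>UNIV. \<bar>A $ j $ k\<bar>) \<le> 1 / 2"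
    and b: "(\<Sum>k\<in>UNIV. b $ k) = 1"
  shows "norm (v (t + h) - (v t + h *\<^sub>R (rk_Lambda A b c U t h *v v t)))
    \<le> B * (\<Sum>k\<in>UNIV. \<bar>b $ k\<bar> * integral {t..t + h} (\<lambda>s. norm (U s - U (t + c $ k * h))))
      + M\<^sup>2 * B * (1 + 2 * (\<Sum>j\<in>UNIV. \<Sum>k\<in>UNIV. \<bar>A $ j $ k\<bar>) * (\<Sum>k\<in>UNIV. \<bar>b $ k\<bar>)) * h\<^sup>2"
    (is "_ \<le> B * ?quad + M\<^sup>2 * B * (1 + 2 * ?\<alpha> * ?\<beta>) * h\<^sup>2")
proof -
  define Q where "Q = (\<Sum>k\<in>UNIV. (b $ k) *\<^sub>R (U (t + c $ k * h) *v v t))"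
  define G where "G s = B * (\<Sum>k\<in>UNIV. \<bar>b $ k\<bar> * norm (U s - U (t + c $ k * h))) + M\<^sup>2 * B * h" for s
  have M0: "0 \<le> M"
    using M[of 0] norm_ge_zero order_trans by blast
  have Bt: "norm (v t) \<le> B"
    using t h by (intro B) auto
  then have B0: "0 \<le> B"
    using norm_ge_zero order_trans by blast
  have int: "(\<lambda>s. norm (U s - U x)) integrable_on {t..t + h}" for x
  proof (rule set_lebesgue_integral_eq_integral(1), rule absolutely_integrable_bounded_ae_continuous[OF _ ae])
    show "continuous_on ({t..t + h} - {t. \<not> isCont U t}) (\<lambda>s. norm (U s - U x))"
      by (intro continuous_intros continuous_at_imp_continuous_on) auto
    show "norm (norm (U s - U x)) \<le> 2 * M" for s
      using norm_triangle_ineq4[of "U s" "U x"] M[of s] M[of x] by simp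
  qed
  have I1: "(\<lambda>s. U s *v v s) integrable_on {t..t + h}"
    by (rule exact_solution_integrable[OF ex t])
  \<comment> \<open>\<open>G\<close> majorizes the integrand of the truncation error; the \<open>O(h)\<close> term in it comes from the
    Lipschitz constant \<open>M B\<close> of the solution.\<close>
  have GI: "(G has_integral B * ?quad + M\<^sup>2 * B * h * h) {t..t + h}"
  proof -
    have "((\<lambda>_. M\<^sup>2 * B * h) has_integral M\<^sup>2 * B * h * h) {t..t + h}"
      using has_integral_const_real[of "M\<^sup>2 * B * h" t "t + h"] h by (simp add: mult_ac)
    then show ?thesis
      unfolding G_def using int
      by (intro has_integral_add has_integral_mult_right has_integral_sum integrable_integral) auto
  qed
  have "v (t + h) - v t - h *\<^sub>R Q = integral {t..t + h} (\<lambda>s. U s *v v s) - integral {t..t + h} (\<lambda>_. Q)"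
    using h t by (subst exact_solution_diff[OF ex]) auto
  also have "\<dots> = integral {t..t + h} (\<lambda>s. U s *v v s - Q)"
    by (rule Henstock_Kurzweil_Integration.integral_diff[OF I1, symmetric]) (rule integrable_const_ivl)
  finally have eq: "v (t + h) - v t - h *\<^sub>R Q = \<dots>" .
  have quad: "norm (v (t + h) - v t - h *\<^sub>R Q) \<le> B * ?quad + M\<^sup>2 * B * h * h"
    unfolding eq integral_unique[OF GI, symmetric]
  proof (rule integral_norm_bound_integral)
    fix s assume s: "s \<in> {t..t + h}"
    have "U s *v v t = (\<Sum>k\<in>UNIV. (b $ k) *\<^sub>R (U s *v v t))"
      by (simp add: b flip: scaleR_sum_left)
    then have "U s *v v s - Q
        = U s *v (v s - v t) + (\<Sum>k\<in>UNIV. (b $ k) *\<^sub>R ((U s - U (t + c $ k * h)) *v v t))"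
      by (simp add: Q_def mv.diff_right mv.diff_left scaleR_diff_right sum_subtractf)
    also have "norm \<dots> \<le> M * (M * B * h) + (\<Sum>k\<in>UNIV. \<bar>b $ k\<bar> * (norm (U s - U (t + c $ k * h)) * B))"
    proof (rule order_trans[OF norm_triangle_ineq], rule add_mono)
      have "norm (v s - v t) \<le> M * B * (s - t)"
        using s t by (intro exact_solution_lipschitz[OF ex M B]) auto
      also have "\<dots> \<le> M * B * h"
        using s M0 B0 by (intro mult_left_mono) auto
      finally show "norm (U s *v (v s - v t)) \<le> M * (M * B * h)"
        by (rule norm_matrix_vector_mult_bound[OF M])
      have "norm ((U s - U (t + c $ k * h)) *v v t) \<le> norm (U s - U (t + c $ k * h)) * B" for k
        using norm_matrix_vector_mult_le[of "U s - U (t + c $ k * h)" "v t"]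
          mult_left_mono[OF Bt norm_ge_zero] order_trans by blast
      then show "norm (\<Sum>k\<in>UNIV. (b $ k) *\<^sub>R ((U s - U (t + c $ k * h)) *v v t))
          \<le> (\<Sum>k\<in>UNIV. \<bar>b $ k\<bar> * (norm (U s - U (t + c $ k * h)) * B))"
        by (intro sum_norm_le) (simp add: mult_left_mono)
    qed
    also have "\<dots> = G s"
      by (simp add: G_def sum_distrib_left mult_ac power2_eq_square)
    finally show "norm (U s *v v s - Q) \<le> G s" .
  next
    show "(\<lambda>s. U s *v v s - Q) integrable_on {t..t + h}"
      by (intro Henstock_Kurzweil_Integration.integrable_diff I1 integrable_const_ivl)
    show "G integrable_on {t..t + h}"
      using GI by blast
  qed
  have "norm (h *\<^sub>R (rk_Lambda A b c U t h *v v t) - h *\<^sub>R Q) \<le> 2 * h\<^sup>2 * M\<^sup>2 * ?\<alpha> * ?\<beta> * norm (v t)"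
    unfolding Q_def by (rule rk_step_bounds(2)[OF M h small])
  also have "\<dots> \<le> 2 * h\<^sup>2 * M\<^sup>2 * ?\<alpha> * ?\<beta> * B"
    by (intro mult_left_mono[OF Bt] mult_nonneg_nonneg sum_nonneg) auto
  finally have step: "norm (h *\<^sub>R (rk_Lambda A b c U t h *v v t) - h *\<^sub>R Q) \<le> \<dots>" .
  have "v (t + h) - (v t + h *\<^sub>R (rk_Lambda A b c U t h *v v t))
      = (v (t + h) - v t - h *\<^sub>R Q) - (h *\<^sub>R (rk_Lambda A b c U t h *v v t) - h *\<^sub>R Q)"
    by simp
  also have "norm \<dots> \<le> (B * ?quad + M\<^sup>2 * B * h * h) + 2 * h\<^sup>2 * M\<^sup>2 * ?\<alpha> * ?\<beta> * B"
    using norm_triangle_ineq4 add_mono[OF quad step] order_trans by blast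
  also have "\<dots> = B * ?quad + M\<^sup>2 * B * (1 + 2 * ?\<alpha> * ?\<beta>) * h\<^sup>2"
    by (simp add: algebra_simps power2_eq_square)
  finally show ?thesis .
qed

lemma discrete_gronwall:
  fixes e \<delta> :: "nat \<Rightarrow> real"
  assumes step: "\<And>n. n < N \<Longrightarrow> e (Suc n) \<le> (1 + x) * e n + \<delta> n"
    and e0: "e 0 \<le> 0" and x: "0 \<le> x" and \<delta>: "\<And>n. n < N \<Longrightarrow> 0 \<le> \<delta> n" and "n \<le> N"
  shows "e n \<le> exp (of_nat n * x) * (\<Sum>i<n. \<delta> i)"
  using \<open>n \<le> N\<close>
proof (induction n)
  case (Suc n)
  have S: "0 \<le> (\<Sum>i<n. \<delta> i)"
    using Suc.prems by (intro sum_nonneg \<delta>) auto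
  have "e (Suc n) \<le> (1 + x) * e n + \<delta> n"
    using Suc.prems by (intro step) auto
  also have "(1 + x) * e n \<le> exp x * (exp (of_nat n * x) * (\<Sum>i<n. \<delta> i))"
  proof -
    have "(1 + x) * e n \<le> (1 + x) * (exp (of_nat n * x) * (\<Sum>i<n. \<delta> i))"
      using Suc x by (intro mult_left_mono) auto
    also have "\<dots> \<le> exp x * (exp (of_nat n * x) * (\<Sum>i<n. \<delta> i))"
      using S by (intro mult_right_mono exp_ge_add_one_self mult_nonneg_nonneg) auto
    finally show ?thesis .
  qed
  also have "exp x * (exp (of_nat n * x) * (\<Sum>i<n. \<delta> i)) = exp (of_nat (Suc n) * x) * (\<Sum>i<n. \<delta> i)"
    by (simp add: exp_add[symmetric] algebra_simps)
  also have "\<delta> n \<le> exp (of_nat (Suc n) * x) * \<delta> n"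
    using mult_right_mono[of 1 "exp (of_nat (Suc n) * x)" "\<delta> n"] \<delta>[of n] Suc.prems x by simp
  finally show ?case
    by (simp add: algebra_simps)
qed (simp add: e0)

text \<open>On the open interval of step \<open>n\<close> the node function has the constant value \<open>t\<^sub>n + \<gamma> h\<close>. It
  jumps at the right end, which is invisible to the integral.\<close>

lemma sum_integral_rk_node_diff:
  fixes U :: "real \<Rightarrow> 'a::euclidean_space"
  assumes h: "0 < h" and M: "\<And>t. norm (U t) \<le> M" and ae: "negligible {t. \<not> isCont U t}"
  shows "(\<Sum>n<m. integral {T1 + of_nat n * h..T1 + of_nat n * h + h}
            (\<lambda>s. norm (U s - U (T1 + of_nat n * h + \<gamma> * h))))
       = integral {T1..T1 + of_nat m * h} (\<lambda>s. norm (U s - U (rk_node T1 h \<gamma> s)))"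
proof (induction m)
  case (Suc m)
  let ?f = "\<lambda>s. norm (U s - U (rk_node T1 h \<gamma> s))"
  let ?t = "T1 + of_nat m * h"
  have "integral {?t..?t + h} (\<lambda>s. norm (U s - U (?t + \<gamma> * h))) = integral {?t..?t + h} ?f"
    unfolding integral_open_interval_real
    by (rule integral_cong) (use h in \<open>simp add: rk_node_eq[of h T1 m] algebra_simps\<close>)
  moreover have "integral {T1..?t} ?f + integral {?t..?t + h} ?f = integral {T1..?t + h} ?f"
  proof (rule Henstock_Kurzweil_Integration.integral_combine)
    show "?f integrable_on {T1..?t + h}"
      by (rule set_lebesgue_integral_eq_integral(1)[OF absolutely_integrable_rk_node_diff[OF h M ae]])
  qed (use h in auto)
  ultimately show ?case
    using Suc by (simp add: algebra_simps)
qed simp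

text \<open>By the discrete Gronwall inequality the error is at most a constant times the sum of the
  truncation errors. The parts \<open>O(h\<^sup>2)\<close> add up to \<open>O(h)\<close>, and the quadrature parts add up to
  integrals over \<open>[T1, T2]\<close> that tend to \<open>0\<close>.\<close>

theorem rk_convergent_bounded_ae_continuous:
  fixes A :: "real^'s^'s" and b c :: "real^'s::finite"
  assumes M: "\<And>t. norm (U t) \<le> M" and ae: "negligible {t. \<not> isCont U t}"
    and T: "T1 < T2" and b: "(\<Sum>k\<in>UNIV. b $ k) = 1"
  shows "rk_convergent A b c U T1 T2"
proof -
  define \<alpha> where "\<alpha> = (\<Sum>j\<in>UNIV. \<Sum>k\<in>UNIV. \<bar>A $ j $ k\<bar>)"
  define \<beta> where "\<beta> = (\<Sum>k\<in>UNIV. \<bar>b $ k\<bar>)"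
  define h where "h N = (T2 - T1) / of_nat N" for N :: nat
  define J where "J N k = integral {T1..T2} (\<lambda>s. norm (U s - U (rk_node T1 (h N) (c $ k) s)))" for N k
  have M0: "0 \<le> M"
    using M[of 0] norm_ge_zero order_trans by blast
  have \<alpha>\<beta>: "0 \<le> \<alpha>" "0 \<le> \<beta>"
    by (auto simp: \<alpha>_def \<beta>_def intro!: sum_nonneg)
  have h0: "h \<longlonglongrightarrow> 0"
    unfolding h_def by (rule lim_const_over_n)
  have "(\<lambda>N. h N * (M * \<alpha>)) \<longlonglongrightarrow> 0"
    using tendsto_mult_right[OF h0] by simp
  then have "\<forall>\<^sub>F N in sequentially. h N * (M * \<alpha>) < 1 / 2"
    by (rule order_tendstoD) simp
  then have small: "\<forall>\<^sub>F N in sequentially. 0 < N \<and> h N * M * \<alpha> \<le> 1 / 2"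
    using eventually_gt_at_top[of 0] by eventually_elim (simp add: mult_ac)
  have hpos: "0 < h N" if "0 < N" for N
    using T that by (simp add: h_def)
  have well: "\<forall>\<^sub>F N in sequentially. rk_well_defined A c U T1 T2 N"
    using small
  proof eventually_elim
    case (elim N)
    then have "invertible (rk_system A c U t (h N))" for t
      using less_imp_le[OF hpos] by (intro rk_system_invertible[OF M]) (auto simp: \<alpha>_def)
    then show ?case
      by (simp add: rk_well_defined_def h_def)
  qed
  have conv: "rk_error A b c U T1 T2 v0 v \<longlonglongrightarrow> 0" if ex: "exact_solution U T1 T2 v0 v" for v0 v
  proof -
    obtain B where B0: "0 \<le> B" and B: "\<And>t. t \<in> {T1..T2} \<Longrightarrow> norm (v t) \<le> B"
      using exact_solution_bounded[OF ex] by blast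
    define C where "C = M\<^sup>2 * B * (1 + 2 * \<alpha> * \<beta>)"
    define E where "E N = exp (2 * M * \<beta> * (T2 - T1)) * (B * (\<Sum>k\<in>UNIV. \<bar>b $ k\<bar> * J N k) + C * (T2 - T1) * h N)" for N
    have "norm (rk_solution A b c U T1 (h N) v0 n - v (T1 + of_nat n * h N)) \<le> E N"
      if N: "0 < N" and sm: "h N * M * \<alpha> \<le> 1 / 2" and n: "n \<le> N" for N n
    proof -
      define t where "t n = T1 + of_nat n * h N" for n
      define w where "w n = rk_solution A b c U T1 (h N) v0 n" for n
      define e where "e n = norm (w n - v (t n))" for n
      define \<delta> where "\<delta> n = B * (\<Sum>k\<in>UNIV. \<bar>b $ k\<bar> * integral {t n..t n + h N} (\<lambda>s. norm (U s - U (t n + c $ k * h N))))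
          + C * (h N)\<^sup>2" for n
      note hp = hpos[OF N]
      have tN: "t N = T2"
        using N by (simp add: t_def h_def)
      have tS: "t (Suc n) = t n + h N" for n
        by (simp add: t_def algebra_simps)
      have tr: "T1 \<le> t n" "t n + h N \<le> T2" if "n < N" for n
      proof -
        have "real (Suc n) * h N \<le> real N * h N"
          using that hp by (intro mult_right_mono) auto
        then show "t n + h N \<le> T2"
          unfolding tN[symmetric] by (simp add: t_def algebra_simps)
      qed (use hp in \<open>simp add: t_def\<close>)
      have trunc: "norm (v (t n + h N) - (v (t n) + h N *\<^sub>R (rk_Lambda A b c U (t n) (h N) *v v (t n)))) \<le> \<delta> n"
        if "n < N" for n
        unfolding \<delta>_def C_def \<alpha>_def \<beta>_def
        using rk_truncation_error[OF ex M ae B hp tr[OF that] sm[unfolded \<alpha>_def] b] by simp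
      have \<delta>0: "0 \<le> \<delta> n" if "n < N" for n
        using trunc[OF that] norm_ge_zero order_trans by blast
      have start: "v T1 = v0"
        using ex T by (simp add: exact_solution_def)
      have step: "e (Suc m) \<le> (1 + 2 * h N * M * \<beta>) * e m + \<delta> m" if m: "m < N" for m
      proof -
        let ?L = "\<lambda>x. h N *\<^sub>R (rk_Lambda A b c U (t m) (h N) *v x)"
        \<comment> \<open>The step is linear, so it maps the error to the error up to the truncation error.\<close>
        have "w (Suc m) - v (t (Suc m)) = (w m - v (t m)) + ?L (w m - v (t m))
            - (v (t m + h N) - (v (t m) + ?L (v (t m))))"
          by (simp add: w_def Let_def tS mv.diff_right scaleR_diff_right flip: t_def)
        then have "e (Suc m) \<le> norm (w m - v (t m)) + norm (?L (w m - v (t m)))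
            + norm (v (t m + h N) - (v (t m) + ?L (v (t m))))"
          unfolding e_def using norm_triangle_ineq4 norm_triangle_ineq
          by (smt (verit, best))
        also have "norm (?L (w m - v (t m))) \<le> 2 * h N * M * \<beta> * e m"
          unfolding e_def \<beta>_def using sm unfolding \<alpha>_def by (intro rk_step_bounds(1)[OF M hp])
        also have "norm (v (t m + h N) - (v (t m) + ?L (v (t m)))) \<le> \<delta> m"
          by (rule trunc[OF m])
        finally show ?thesis
          by (simp add: e_def algebra_simps)
      qed
      have \<delta>sum: "(\<Sum>i<N. \<delta> i) = B * (\<Sum>k\<in>UNIV. \<bar>b $ k\<bar> * J N k) + C * (T2 - T1) * h N"
      proof -
        have "(\<Sum>i<N. integral {t i..t i + h N} (\<lambda>s. norm (U s - U (t i + c $ k * h N)))) = J N k" for k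
          unfolding J_def tN[symmetric] unfolding t_def by (rule sum_integral_rk_node_diff[OF hp M ae])
        moreover have "(\<Sum>i<N. \<delta> i) = B * (\<Sum>k\<in>UNIV. \<bar>b $ k\<bar> *
            (\<Sum>i<N. integral {t i..t i + h N} (\<lambda>s. norm (U s - U (t i + c $ k * h N))))) + C * (of_nat N * h N) * h N"
          unfolding \<delta>_def sum.distrib sum_distrib_left
          by (subst sum.swap) (simp add: power2_eq_square mult_ac)
        moreover have "of_nat N * h N = T2 - T1"
          using N by (simp add: h_def)
        ultimately show ?thesis
          by simp
      qed
      have "e n \<le> exp (of_nat n * (2 * h N * M * \<beta>)) * (\<Sum>i<n. \<delta> i)"
        using hp M0 \<alpha>\<beta>
        by (intro discrete_gronwall[where N = N and e = e and \<delta> = \<delta>, OF step _ _ _ n]) (auto simp: e_def w_def t_def start \<delta>0)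
      also have "\<dots> \<le> exp (of_nat N * (2 * h N * M * \<beta>)) * (\<Sum>i<N. \<delta> i)"
        using n hp M0 \<alpha>\<beta> \<delta>0
        by (intro mult_mono sum_mono2 sum_nonneg) (auto intro!: mult_right_mono)
      also have "of_nat N * (2 * h N * M * \<beta>) = 2 * M * \<beta> * (T2 - T1)"
        using N by (simp add: h_def)
      finally show ?thesis
        unfolding \<delta>sum by (simp add: E_def e_def w_def t_def)
    qed
    note bound = this
    have "\<forall>\<^sub>F N in sequentially. norm (rk_error A b c U T1 T2 v0 v N) \<le> E N"
      using small
    proof (rule eventually_mono)
      fix N assume N: "0 < N \<and> h N * M * \<alpha> \<le> 1 / 2"
      let ?S = "(\<lambda>n. norm (rk_solution A b c U T1 (h N) v0 n - v (T1 + of_nat n * h N))) ` {0..N}"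
      have "Max ?S \<in> ?S"
        by (rule Max_in) auto
      then obtain n where "n \<le> N"
        and n: "Max ?S = norm (rk_solution A b c U T1 (h N) v0 n - v (T1 + of_nat n * h N))"
        by (elim imageE) simp
      then have "0 \<le> Max ?S" "Max ?S \<le> E N"
        using bound[of N n] N by auto
      then show "norm (rk_error A b c U T1 T2 v0 v N) \<le> E N"
        by (simp add: rk_error_def Let_def flip: h_def)
    qed
    moreover have "E \<longlonglongrightarrow> 0"
    proof -
      have "(\<lambda>N. J N k) \<longlonglongrightarrow> 0" for k
        unfolding J_def h_def by (rule integral_rk_node_diff_tendsto_0[OF M ae T])
      then have "E \<longlonglongrightarrow> exp (2 * M * \<beta> * (T2 - T1)) * (B * (\<Sum>k\<in>UNIV. \<bar>b $ k\<bar> * 0) + C * (T2 - T1) * 0)"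
        unfolding E_def using h0 by (intro tendsto_intros)
      then show ?thesis
        by simp
    qed
    ultimately show ?thesis
      by (rule Lim_null_comparison)
  qed
  show ?thesis
    unfolding rk_convergent_def using well exact_solution_exists[OF M ae] conv by blast
qed

section \<open>The Zakharov-Shabat system\<close>

lemma norm_ZS_matrix_le:
  "norm (ZS_matrix q r (of_real \<xi>) t) \<le> norm (q t) + norm (r t)"
proof -
  have e: "norm (exp (2 * \<i> * of_real \<xi> * of_real t)) = 1" "norm (exp (- (2 * \<i> * of_real \<xi> * of_real t))) = 1"
    by (simp_all add: norm_exp_eq_Re)
  have "norm (ZS_matrix q r (of_real \<xi>) t) = L2_set (\<lambda>i. norm (ZS_matrix q r (of_real \<xi>) t $ i)) UNIV"
    by (simp add: norm_vec_def)
  also have "\<dots> \<le> (\<Sum>i\<in>UNIV. norm (ZS_matrix q r (of_real \<xi>) t $ i))"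
    by (rule L2_set_le_sum) auto
  also have "\<dots> = norm (q t) + norm (r t)"
    by (simp add: ZS_matrix_def sum_2 norm_vec_def L2_set_def norm_mult e)
  finally show ?thesis .
qed

lemma isCont_ZS_matrix:
  assumes "isCont q t" "isCont r t"
  shows "isCont (ZS_matrix q r \<zeta>) t"
proof -
  have "isCont (\<lambda>t. ZS_matrix q r \<zeta> t $ i $ j) t" for i j
    using exhaust_2[of i] exhaust_2[of j]
    by (elim disjE; simp add: ZS_matrix_def) (intro continuous_intros assms)+
  then show ?thesis
    unfolding isCont_def by (intro vec_tendstoI)
qed

theorem proposition2p3:
  fixes q r :: "real \<Rightarrow> complex"
    and \<kappa> \<xi> T1 T2 :: real
    and A :: "real^('s::{finite,linorder})^('s::{finite,linorder})"
    and b c :: "real^('s::{finite,linorder})"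
  assumes "compact (supp q)"
    and "bounded (q ` supp q)"
    and "negligible {t. \<not> isCont q t}"
    and "\<kappa> \<in> {1, - 1}"
    and "r = (\<lambda>t. of_real \<kappa> * cnj (q t))"
    and "T1 < T2" and "supp q \<subseteq> {T1..T2}"
    and "mono (\<lambda>j. c $ j)" and "\<forall>j. 0 \<le> c $ j \<and> c $ j \<le> 1"
    and "(\<Sum>j\<in>UNIV. b $ j) = 1"
  shows "rk_convergent A b c (ZS_matrix q r (of_real \<xi>)) T1 T2"
proof -
  obtain K where K: "0 < K" "\<And>t. t \<in> supp q \<Longrightarrow> norm (q t) \<le> K"
    using \<open>bounded (q ` supp q)\<close> by (auto simp: bounded_pos)
  have q: "norm (q t) \<le> K" for t
  proof (cases "q t = 0")
    case False
    then have "t \<in> supp q"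
      unfolding supp_def by (intro closure_subset[THEN subsetD]) simp
    then show ?thesis
      by (rule K)
  qed (use K in simp)
  have r: "norm (r t) = norm (q t)" for t
    using \<open>\<kappa> \<in> {1, - 1}\<close> by (auto simp: assms(5) norm_mult)
  have bound: "norm (ZS_matrix q r (of_real \<xi>) t) \<le> 2 * K" for t
    using norm_ZS_matrix_le[of q r \<xi> t] q[of t] r[of t] by simp
  have "isCont (ZS_matrix q r (of_real \<xi>)) t" if "isCont q t" for t
    using that by (intro isCont_ZS_matrix) (auto simp: assms(5) intro!: continuous_intros)
  then have ae: "negligible {t. \<not> isCont (ZS_matrix q r (of_real \<xi>)) t}"
    by (intro negligible_subset[OF \<open>negligible {t. \<not> isCont q t}\<close>]) auto
  show ?thesis
    by (rule rk_convergent_bounded_ae_continuous[OF bound ae]) fact+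
qed

end
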